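(* Let $\omega_F>0$ and let $F:\mathbb{R}\to\mathbb{R}$ be a $C^\infty$ periodic function of period $\frac{2\pi}{\omega_F}$ with $F(0)=0$, having finitely many zeros in $(0,\frac{2\pi}{\omega_F}]$, at each of which $F$ changes sign. Let $0<t_1<\dots<t_N=\frac{2\pi}{\omega_F}$ be these zeros, so that $N$ is the number of times $F$ changes sign over one period. For $\lambda>0$ let $\bar\omega^+$ and $\bar\omega^-$ be the unique fixed points of the respective maps on $\mathbb{R}$ $$\hat\omega^+_{n+1}=\hat\omega^+_n e^{-\lambda\frac{2\pi}{\omega_F}}+\pi e^{-\lambda\frac{2\pi}{\omega_F}}\sum_{i=1}^N e^{\lambda t_i},\qquad \hat\omega^-_{n+1}=\hat\omega^-_n e^{-\lambda\frac{2\pi}{\omega_F}}+\pi e^{-\lambda\frac{2\pi}{\omega_F}}\left(1+\sum_{i=1}^{N-1}e^{\lambda t_i}\right).$$ Then the average $\tilde\omega=\frac{\bar\omega^++\bar\omega^-}{2}$ (which depends on $\lambda$) satisfies $$\lim_{\lambda\to0}\lambda\tilde\omega=\omega_F\frac N2 .$$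
   Context: Explicitly, $\bar\omega^+=\frac{\pi}{e^{2\pi\lambda/\omega_F}-1}\sum_{i=1}^N e^{\lambda t_i}$ and $\bar\omega^-=\frac{\pi}{e^{2\pi\lambda/\omega_F}-1}\left(1+\sum_{i=1}^{N-1}e^{\lambda t_i}\right)$. The limit is over $\lambda>0$. *)

theory Defs
  imports "HOL-Analysis.Analysis" "HOL-Library.Periodic_Fun"
begin

definition smooth :: "(real \<Rightarrow> real) \<Rightarrow> bool" where
  "smooth F \<longleftrightarrow> (\<forall>k. (deriv ^^ k) F differentiable_on UNIV)"

definition changes_sign_at :: "(real \<Rightarrow> real) \<Rightarrow> real \<Rightarrow> bool" where
  "changes_sign_at F x \<longleftrightarrow>
     (\<exists>\<epsilon>>0. (\<forall>y\<in>{x - \<epsilon><..<x}. F y < 0) \<and> (\<forall>y\<in>{x<..<x + \<epsilon>}. F y > 0)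
         \<or> (\<forall>y\<in>{x - \<epsilon><..<x}. F y > 0) \<and> (\<forall>y\<in>{x<..<x + \<epsilon>}. F y < 0))"

definition zeros_in_period :: "(real \<Rightarrow> real) \<Rightarrow> real \<Rightarrow> real set" where
  "zeros_in_period F T = {x \<in> {0<..T}. F x = 0}"

definition omega_plus_map :: "real \<Rightarrow> nat \<Rightarrow> (nat \<Rightarrow> real) \<Rightarrow> real \<Rightarrow> real \<Rightarrow> real" where
  "omega_plus_map \<omega>\<^sub>F N t l w =
     w * exp (- l * (2 * pi / \<omega>\<^sub>F)) +
     pi * exp (- l * (2 * pi / \<omega>\<^sub>F)) * (\<Sum>i=1..N. exp (l * t i))"

definition omega_minus_map :: "real \<Rightarrow> nat \<Rightarrow> (nat \<Rightarrow> real) \<Rightarrow> real \<Rightarrow> real \<Rightarrow> real" where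
  "omega_minus_map \<omega>\<^sub>F N t l w =
     w * exp (- l * (2 * pi / \<omega>\<^sub>F)) +
     pi * exp (- l * (2 * pi / \<omega>\<^sub>F)) * (1 + (\<Sum>i=1..N-1. exp (l * t i)))"

text \<open>For \<open>l > 0\<close> both maps have exactly one fixed point (shown below), so the
  definite descriptions denote; for \<open>l \<le> 0\<close> their values are not used.\<close>

definition omega_plus :: "real \<Rightarrow> nat \<Rightarrow> (nat \<Rightarrow> real) \<Rightarrow> real \<Rightarrow> real" where
  "omega_plus \<omega>\<^sub>F N t l = (THE w. omega_plus_map \<omega>\<^sub>F N t l w = w)"

definition omega_minus :: "real \<Rightarrow> nat \<Rightarrow> (nat \<Rightarrow> real) \<Rightarrow> real \<Rightarrow> real" where
  "omega_minus \<omega>\<^sub>F N t l = (THE w. omega_minus_map \<omega>\<^sub>F N t l w = w)"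

definition omega_avg :: "real \<Rightarrow> nat \<Rightarrow> (nat \<Rightarrow> real) \<Rightarrow> real \<Rightarrow> real" where
  "omega_avg \<omega>\<^sub>F N t l = (omega_plus \<omega>\<^sub>F N t l + omega_minus \<omega>\<^sub>F N t l) / 2"

lemma affine_unique_fixed_point:
  fixes q c :: real
  assumes "q \<noteq> 1"
  shows "\<exists>!w. w * q + c = w"
proof (rule ex1I)
  show "c / (1 - q) * q + c = c / (1 - q)"
    using assms by (simp add: field_simps)
  show "w = c / (1 - q)" if "w * q + c = w" for w
    using assms that by (simp add: field_simps)
qed

lemma
  assumes "\<omega>\<^sub>F > 0" "l > 0"
  shows omega_plus_map_unique_fixed_point: "\<exists>!w. omega_plus_map \<omega>\<^sub>F N t l w = w"
    and omega_minus_map_unique_fixed_point: "\<exists>!w. omega_minus_map \<omega>\<^sub>F N t l w = w"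
  unfolding omega_plus_map_def omega_minus_map_def
  by (rule affine_unique_fixed_point, use assms in simp)+

lemma changes_sign_at_imp_zero:
  assumes "changes_sign_at F x" "isCont F x"
  shows "F x = 0"
proof -
  have L: "(F \<longlongrightarrow> F x) (at_left x)" and R: "(F \<longlongrightarrow> F x) (at_right x)"
    using assms(2) by (auto simp: isCont_def intro: filterlim_at_within_not_equal tendsto_within_subset)
  obtain e where e: "e > 0"
    "(\<forall>y\<in>{x - e<..<x}. F y < 0) \<and> (\<forall>y\<in>{x<..<x + e}. F y > 0)
         \<or> (\<forall>y\<in>{x - e<..<x}. F y > 0) \<and> (\<forall>y\<in>{x<..<x + e}. F y < 0)"
    using assms(1) unfolding changes_sign_at_def by blast
  have evL: "eventually (\<lambda>y. y \<in> {x - e<..<x}) (at_left x)"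
    using e(1) by (intro eventually_at_leftI[of "x - e"]) auto
  have evR: "eventually (\<lambda>y. y \<in> {x<..<x + e}) (at_right x)"
    using e(1) by (intro eventually_at_rightI[of x "x + e"]) auto
  from e(2) show ?thesis
  proof
    assume h: "(\<forall>y\<in>{x - e<..<x}. F y < 0) \<and> (\<forall>y\<in>{x<..<x + e}. F y > 0)"
    have "F x \<le> 0" using h by (intro tendsto_upperbound[OF L] eventually_mono[OF evL]) (auto intro: less_imp_le)
    moreover have "F x \<ge> 0" using h by (intro tendsto_lowerbound[OF R] eventually_mono[OF evR]) (auto intro: less_imp_le)
    ultimately show ?thesis by simp
  next
    assume h: "(\<forall>y\<in>{x - e<..<x}. F y > 0) \<and> (\<forall>y\<in>{x<..<x + e}. F y < 0)"
    have "F x \<ge> 0" using h by (intro tendsto_lowerbound[OF L] eventually_mono[OF evL]) (auto intro: less_imp_le)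
    moreover have "F x \<le> 0" using h by (intro tendsto_upperbound[OF R] eventually_mono[OF evR]) (auto intro: less_imp_le)
    ultimately show ?thesis by simp
  qed
qed

text \<open>An increasing enumeration \<open>t\<^sub>1 < \<dots> < t\<^sub>N\<close> of the zeros, all of which are sign changes,
  therefore has \<open>N\<close> equal to the number of sign changes over one period.\<close>

lemma number_of_sign_changes:
  fixes t :: "nat \<Rightarrow> real"
  assumes "smooth F"
    and "\<forall>x \<in> zeros_in_period F T. changes_sign_at F x"
    and "strict_mono_on {1..N} t"
    and "t ` {1..N} = zeros_in_period F T"
  shows "N = card {x \<in> {0<..T}. changes_sign_at F x}"
proof -
  have "F differentiable_on UNIV"
    using assms(1) unfolding smooth_def by (metis funpow_0)
  then have "isCont F x" for x
    using differentiable_imp_continuous_on[of F UNIV] continuous_on_eq_continuous_at by blast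
  then have "{x \<in> {0<..T}. changes_sign_at F x} = zeros_in_period F T"
    using assms(2) changes_sign_at_imp_zero by (auto simp: zeros_in_period_def)
  moreover have "card (t ` {1..N}) = N"
    using card_image[OF strict_mono_on_imp_inj_on[OF assms(3)]] by simp
  ultimately show ?thesis using assms(4) by simp
qed

end

theory Submission
  imports Defs "HOL-Real_Asymp.Real_Asymp"
begin

text \<open>Put T = 2 pi / \<open>\<omega>\<^sub>F\<close> and q = exp (- l T). Both maps are
  affine, w q + pi q S(l), where S is the respective sum of exponentials, so the fixed point is pi q
  S(l) / (1 - q). As l tends to 0 from the right, q tends to 1 and 1 - q behaves like l T, hence l
  times the fixed point tends to pi S(0) / T (\<open>tendsto_scaled_fixed_point\<close>). At l = 0
  every exponential is 1, so S(0) = N for both maps (\<open>tendsto_sum_exp\<close>); both limits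
  are pi N / T, and so is that of the average.\<close>

lemma affine_fixed_point_eq:
  fixes q c :: real
  assumes "q \<noteq> 1"
  shows "(THE w. w * q + c = w) = c / (1 - q)"
proof (rule the1_equality[OF affine_unique_fixed_point[OF assms]])
  show "c / (1 - q) * q + c = c / (1 - q)"
    using assms by (simp add: field_simps)
qed

text \<open>The factor l cancels the simple pole of 1 / (1 - exp (- l T)) at 0, whose residue is 1 /
  T. Keeping \<open>S\<close> abstract lets one limit serve both maps.\<close>

lemma tendsto_scaled_fixed_point:
  fixes T c m :: real and S :: "real \<Rightarrow> real"
  assumes "T > 0" and "(S \<longlongrightarrow> m) (at_right 0)"
  shows "((\<lambda>l. l * (THE w. w * exp (- l * T) + c * exp (- l * T) * S l = w))
           \<longlongrightarrow> c * m / T) (at_right 0)"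
proof -
  have "((\<lambda>l. l * exp (- l * T) / (1 - exp (- l * T))) \<longlongrightarrow> 1 / T) (at_right 0)"
    using \<open>T > 0\<close> by (real_asymp simp: field_simps)
  from tendsto_mult[OF this tendsto_mult_left[OF assms(2), of c]]
  have "((\<lambda>l. l * exp (- l * T) / (1 - exp (- l * T)) * (c * S l)) \<longlongrightarrow> c * m / T) (at_right 0)"
    by simp
  \<comment> \<open>The fixed point is given by the quotient when exp (- l T) differs from 1, as it
    does for every l > 0; agreement near 0 on the right suffices for the limit.\<close>
  moreover have "eventually (\<lambda>l. l * exp (- l * T) / (1 - exp (- l * T)) * (c * S l) =
      l * (THE w. w * exp (- l * T) + c * exp (- l * T) * S l = w)) (at_right 0)"
    using eventually_at_right_less
  proof eventually_elim
    case (elim l)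
    then have "exp (- l * T) \<noteq> 1" using \<open>T > 0\<close> by simp
    then show ?case by (subst affine_fixed_point_eq) simp_all
  qed
  ultimately show ?thesis by (rule Lim_transform_eventually)
qed

lemma tendsto_sum_exp:
  fixes t :: "'a \<Rightarrow> real"
  shows "((\<lambda>l. \<Sum>i\<in>A. exp (l * t i)) \<longlongrightarrow> real (card A)) (at_right 0)"
proof -
  have "((\<lambda>l. \<Sum>i\<in>A. exp (l * t i)) \<longlongrightarrow> (\<Sum>i\<in>A. exp (0 * t i))) (at_right 0)"
    by (intro tendsto_intros)
  then show ?thesis by simp
qed

theorem lemma2p2:
  fixes \<omega>\<^sub>F :: real and F :: "real \<Rightarrow> real" and N :: nat and t :: "nat \<Rightarrow> real"
  assumes "\<omega>\<^sub>F > 0"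
    and "smooth F"
    and "periodic_fun_simple F (2 * pi / \<omega>\<^sub>F)"
    and "F 0 = 0"
    and "finite (zeros_in_period F (2 * pi / \<omega>\<^sub>F))"
    and "\<forall>x \<in> zeros_in_period F (2 * pi / \<omega>\<^sub>F). changes_sign_at F x"
    and "strict_mono_on {1..N} t"
    and "t ` {1..N} = zeros_in_period F (2 * pi / \<omega>\<^sub>F)"
    and "t N = 2 * pi / \<omega>\<^sub>F"
  shows "((\<lambda>l. l * omega_avg \<omega>\<^sub>F N t l) \<longlongrightarrow> \<omega>\<^sub>F * (real N / 2)) (at_right 0)"
proof -
  define T where "T = 2 * pi / \<omega>\<^sub>F"
  have T: "T > 0" using assms(1) by (simp add: T_def)
  \<comment> \<open>By periodicity T itself is a zero, so the enumeration is nonempty. This excludes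
    N = 0, where truncated subtraction would make \<open>N - 1\<close> equal to 0.\<close>
  have "F T = 0"
    using periodic_fun_simple.plus_period[OF assms(3), of 0] assms(4) by (simp add: T_def)
  then have "T \<in> t ` {1..N}"
    using T assms(8) by (simp add: zeros_in_period_def T_def)
  then have N: "N \<ge> 1" by auto
  have lim: "pi * real N / T = \<omega>\<^sub>F * (real N / 2)"
    using assms(1) by (simp add: T_def)
  have plus: "((\<lambda>l. l * omega_plus \<omega>\<^sub>F N t l) \<longlongrightarrow> \<omega>\<^sub>F * (real N / 2)) (at_right 0)"
    using tendsto_scaled_fixed_point[OF T tendsto_sum_exp[of t "{1..N}"], of pi]
    by (simp add: omega_plus_def omega_plus_map_def lim flip: T_def)
  \<comment> \<open>The constant 1 stands in for the N-th exponential: the limit is 1 + (N - 1),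
    which equals N because N is at least 1.\<close>
  have "((\<lambda>l. 1 + (\<Sum>i=1..N-1. exp (l * t i))) \<longlongrightarrow> real N) (at_right 0)"
    using tendsto_add[OF tendsto_const tendsto_sum_exp[of t "{1..N-1}"], of 1] N by simp
  from tendsto_scaled_fixed_point[OF T this, of pi]
  have minus: "((\<lambda>l. l * omega_minus \<omega>\<^sub>F N t l) \<longlongrightarrow> \<omega>\<^sub>F * (real N / 2)) (at_right 0)"
    by (simp add: omega_minus_def omega_minus_map_def lim flip: T_def)
  from tendsto_divide[OF tendsto_add[OF plus minus] tendsto_const, of 2]
  show ?thesis by (simp add: omega_avg_def field_simps)
qed

end
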